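(* Consider the forward Euler update of the cell averages of the DG scheme described in the context, $$\bar f^{\,n+1}_{ikm}=\bar f^{\,n}_{ikm}+\Gamma_T+\Gamma_C ,$$ with time step $\Delta t^n>0$, and fix a cell $\Omega_{ikm}$. Let $\alpha\in(0,1)$ and let $s_1,s_2,s_3\ge 0$ with $s_1+s_2+s_3=1$. Suppose that at time $t^n$ the numerical solution $f_h$ is non-negative at all the quadrature points described in the context, including all one-sided limits $f_h|^{\pm}$ at cell faces that enter the scheme. Suppose that the transport CFL conditions $$\Delta t^n\;\max_{r}\partial_p\varepsilon(p_r)\;\max_{\pm}|\mu_{m\pm}|\;\le\;\alpha\, s_1\,\hat w_N\,\Delta x_i,$$ $$\Delta t^n\; q\,\max_{\ell}|E(x_\ell,t^n)|\;\max_{\pm}|\mu_{m\pm}|\;\le\;\alpha\, s_2\,\hat w_N\,\Delta p_k,$$ $$\Delta t^n\; q\,\max_{\ell}|E(x_\ell,t^n)|\;\max_{\pm}(1-\mu_{m\pm}^2)\;\le\;\alpha\, s_3\,\hat w_N\,\Delta\mu_m\,p_{k-}$$ hold, where the maxima over $r$ and $\ell$ are over the quadrature nodes of the cell in the $p$ and $x$ directions. Suppose in addition that at least one of the following two conditions on the collision term holds: (C1) $f_h$ at time $t^n$ is also non-negative at all the additional points $(x_\ell,\,p(\varepsilon(p_r)+j\hbar\omega),\,\mu'_{s})$, $j\in\{-1,0,1\}$ with $\varepsilon(p_r)+j\hbar\omega\in[0,\varepsilon_{max}]$, at which the gain term is evaluated, and $$\Delta t^n\,\max_{r}\nu(p_r)<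 1-\alpha ;$$ (C2) $$\Delta t^n\le (1-\alpha)\min\left\{\frac{f_h(x_\ell,p_r,\mu_s,t^n)}{|Q(f_h)(x_\ell,p_r,\mu_s,t^n)|}\right\},$$ where the minimum is over those quadrature points $(x_\ell,p_r,\mu_s)$ of $\Omega_{ikm}$ at which $Q(f_h)(x_\ell,p_r,\mu_s,t^n)<0$ (no condition if there are none). Then $$\bar f^{\,n}_{ikm}+\frac{\Gamma_T}{\alpha}\ge 0,\qquad \bar f^{\,n}_{ikm}+\frac{\Gamma_C}{1-\alpha}\ge 0,$$ and consequently $\bar f^{\,n+1}_{ikm}\ge 0$.
   Context: Phase space and mesh. The variables are $x\in[0,L]$, $p\in[0,p_{max}]$, $\mu\in[-1,1]$. The cells are $\Omega_{ikm}=[x_{i-},x_{i+}]\times[p_{k-},p_{k+}]\times[\mu_{m-},\mu_{m+}]$, where $x_{i\pm}=x_{i\pm1/2}$, $p_{k\pm}=p_{k\pm1/2}$, $\mu_{m\pm}=\mu_{m\pm1/2}$, with side lengths $\Delta x_i,\Delta p_k,\Delta\mu_m$. Put $V_{ikm}=\int_{\Omega_{ikm}}p^2\,dp\,d\mu\,dx$. The function $f_h(x,p,\mu,t)$ is, at each time, a polynomial of bounded degree on each cell; superscripts $\mp$ denote one-sided limits at a face ($-$ from the side of smaller values of the coordinate, $+$ from the side of larger values). The cell average is $\bar f_{ikm}=V_{ikm}^{-1}\int_{\Omega_{ikm}}f_h\,p^2\,dp\,d\mu\,dx$, and $\bar f^{\,n}_{ikm}$ is its value at time $t^n$. Data. $\varepsilon(p)$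 is a smooth energy band with $\partial_p\varepsilon>0$, with inverse $p(\varepsilon)$; $\varepsilon_{max}=\varepsilon(p_{max})$; $q>0$ is the electric charge; $E(x,t)$ is the electric field; $\hbar\omega>0$ is the phonon energy; $c_j\geq 0$ ($j=-1,0,1$) are constants, with $c_1=(n_{ph}+1)K$, $c_{-1}=n_{ph}K$. $\chi(\varepsilon)=1$ if $\varepsilon\in[0,\varepsilon_{max}]$ and $0$ otherwise. Collision operator. $$Q(f)(x,p,\mu,t)=2\pi\sum_{j=-1}^{1}c_j\int_{-1}^{1}d\mu'\,\Big[f(x,p(\varepsilon'),\mu',t)\,p^2(\varepsilon')\tfrac{dp}{d\varepsilon'}\chi(\varepsilon')\Big]_{\varepsilon'=\varepsilon(p)+j\hbar\omega}-\nu(p)f(x,p,\mu,t),$$ $$\nu(p)=4\pi\sum_{j=-1}^{1}c_j\Big[p^2(\varepsilon')\tfrac{dp}{d\varepsilon'}\chi(\varepsilon')\Big]_{\varepsilon'=\varepsilon(p)-j\hbar\omega}.$$ Upwind fluxes (all at time $t^n$). $$\widehat{H^{(x)}f_h}|_{x_{i\pm}}=\partial_p\varepsilon\Big[\tfrac{\mu+|\mu|}{2}f_h|^-_{x_{i\pm}}+\tfrac{\mu-|\mu|}{2}f_h|^+_{x_{i\pm}}\Big],$$ $$\widehat{H^{(p)}f_h}|_{p_{k\pm}}=q\Big[\tfrac{-E\mu+|E\mu|}{2}f_h|^-_{p_{k\pm}}+\tfrac{-E\mu-|E\mu|}{2}f_h|^+_{p_{k\pm}}\Big],$$ $$\widehat{H^{(\mu)}f_h}|_{\mu_{m\pm}}=q\Big[\tfrac{-E+|E|}{2}f_h|^-_{\mu_{m\pm}}+\tfrac{-E-|E|}{2}f_h|^+_{\mu_{m\pm}}\Big].$$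 Transport and collision terms. $$\Gamma_T=-\frac{\Delta t^n}{V_{ikm}}\Big[\int_{p_{k-}}^{p_{k+}}\!\!\int_{\mu_{m-}}^{\mu_{m+}}\big(\widehat{H^{(x)}f_h}|_{x_{i+}}-\widehat{H^{(x)}f_h}|_{x_{i-}}\big)p^2\,d\mu\,dp+\int_{x_{i-}}^{x_{i+}}\!\!\int_{\mu_{m-}}^{\mu_{m+}}\big(p_{k+}^2\widehat{H^{(p)}f_h}|_{p_{k+}}-p_{k-}^2\widehat{H^{(p)}f_h}|_{p_{k-}}\big)d\mu\,dx$$ $$\qquad+\int_{x_{i-}}^{x_{i+}}\!\!\int_{p_{k-}}^{p_{k+}}\big((1-\mu_{m+}^2)\widehat{H^{(\mu)}f_h}|_{\mu_{m+}}-(1-\mu_{m-}^2)\widehat{H^{(\mu)}f_h}|_{\mu_{m-}}\big)p\,dp\,dx\Big],$$ $$\Gamma_C=\frac{\Delta t^n}{V_{ikm}}\int_{\Omega_{ikm}}Q(f_h)\,p^2\,dp\,d\mu\,dx .$$ Quadrature. All integrals in the scheme are evaluated by quadrature rules with positive weights of sufficiently high degree. In each cell a tensor-product rule (Gauss or Gauss–Lobatto) with nodes $(x_\ell,p_r,\mu_s)$ is used for the cell integral of the collision term, and the corresponding products of one-dimensional rules are used for the face integrals; the $\mu'$-integral in the gain term is evaluated with positive weights at nodes $\mu'_{s}\in[-1,1]$. In addition there is the $N$-point Gauss–Lobatto rule on each interval, with weights $\hat w_1=\hat w_N,\dots$ normalized to sum to $1$ and nodes containing the interval endpoints. The cell integral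 $\int_{\Omega_{ikm}}f_hp^2$ is evaluated exactly by the tensor rule, and also exactly by each of the three rules obtained by taking the Gauss–Lobatto rule in one of the directions $x$, $p$, $\mu$ and the face rule in the other two. "All the quadrature points" at which $f_h\ge0$ is assumed are the nodes of the tensor rule and of these three rules in the cell (with endpoint values taken as limits from inside the cell), together with the limits from the neighbouring cells (or boundary data) at the face nodes. *)

theory Defs
  imports "HOL-Analysis.Analysis" "HOL-Computational_Algebra.Polynomial"
begin

section \<open>One-dimensional quadrature rules\<close>

text \<open>Rules live on the reference interval \<open>[0,1]\<close> and are transported affinely to \<open>[a,b]\<close>.
  Nodes are numbered from 0, so the endpoint weight written with index \<open>N\<close> in an
  \<open>N\<close>-point rule is \<open>weight R (npts R - 1)\<close>.\<close>

record quadrule =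
  npts :: nat
  node :: "nat \<Rightarrow> real"
  weight :: "nat \<Rightarrow> real"

definition positive_rule :: "quadrule \<Rightarrow> bool" where
  "positive_rule R \<longleftrightarrow> npts R \<ge> 1 \<and> (\<forall>a<npts R. node R a \<in> {0..1} \<and> weight R a > 0)"

definition exact_to_degree :: "quadrule \<Rightarrow> nat \<Rightarrow> bool" where
  "exact_to_degree R D \<longleftrightarrow>
     (\<forall>P :: real poly. degree P \<le> D \<longrightarrow>
        (\<Sum>a<npts R. weight R a * poly P (node R a)) = integral {0..1} (poly P))"

definition gauss_rule :: "quadrule \<Rightarrow> bool" where
  "gauss_rule R \<longleftrightarrow> positive_rule R \<and>
     (\<forall>a b. a < b \<and> b < npts R \<longrightarrow> node R a < node R b) \<and>
     exact_to_degree R (2 * npts R - 1)"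

text \<open>The last two conjuncts (normalization and equality of the two endpoint weights) are
  standard consequences of the others.\<close>

definition gauss_lobatto_rule :: "quadrule \<Rightarrow> bool" where
  "gauss_lobatto_rule R \<longleftrightarrow> positive_rule R \<and> npts R \<ge> 2 \<and>
     (\<forall>a b. a < b \<and> b < npts R \<longrightarrow> node R a < node R b) \<and>
     node R 0 = 0 \<and> node R (npts R - 1) = 1 \<and>
     exact_to_degree R (2 * npts R - 3) \<and>
     (\<Sum>a<npts R. weight R a) = 1 \<and> weight R 0 = weight R (npts R - 1)"

definition qint :: "quadrule \<Rightarrow> real \<Rightarrow> real \<Rightarrow> (real \<Rightarrow> real) \<Rightarrow> real" where
  "qint R a b g = (b - a) * (\<Sum>l<npts R. weight R l * g (a + (b - a) * node R l))"

definition qnodes :: "quadrule \<Rightarrow> real \<Rightarrow> real \<Rightarrow> real set" where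
  "qnodes R a b = (\<lambda>l. a + (b - a) * node R l) ` {..<npts R}"

section \<open>Data of the scheme\<close>

text \<open>Cells are numbered from 1, and the interface with half-integer index \<open>i + 1/2\<close> is
  \<open>xface i\<close>; thus cell \<open>i\<close> is \<open>[xface (i - 1), xface i]\<close>, and similarly in \<open>p\<close> and \<open>\<mu>\<close>.

  Boundary data are one-sided limits from outside at \<open>x = 0\<close>, \<open>x = L\<close> and \<open>p = p_max\<close>, as
  functions of the two tangential coordinates (in the order \<open>x, p, \<mu>\<close>) and time.

  \<open>psel k p\<close> is the cell whose side is used when \<open>f_h\<close> is evaluated, as seen from cell \<open>k\<close>,
  at a point with momentum \<open>p\<close>; likewise \<open>msel\<close>. This matters only for evaluation points of the
  gain term that lie on a cell interface, where \<open>f_h\<close> is double-valued.\<close>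

record dg =
  Lx :: real
  pmax :: real
  Nx :: nat
  Np :: nat
  Nm :: nat
  xface :: "nat \<Rightarrow> real"
  pface :: "nat \<Rightarrow> real"
  mface :: "nat \<Rightarrow> real"
  deg :: nat
  fh :: "real \<Rightarrow> real \<Rightarrow> real \<Rightarrow> real \<Rightarrow> real"
  bd_x0 :: "real \<Rightarrow> real \<Rightarrow> real \<Rightarrow> real"
  bd_xL :: "real \<Rightarrow> real \<Rightarrow> real \<Rightarrow> real"
  bd_pmax :: "real \<Rightarrow> real \<Rightarrow> real \<Rightarrow> real"
  eps :: "real \<Rightarrow> real"
  charge :: real
  Efield :: "real \<Rightarrow> real \<Rightarrow> real"
  hw :: real
  nph :: real
  Kcoef :: real
  ccoef :: "int \<Rightarrow> real"
  rule_x :: quadrule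
  rule_p :: quadrule
  rule_m :: quadrule
  rule_gain :: quadrule
  rule_GL :: quadrule
  psel :: "nat \<Rightarrow> real \<Rightarrow> nat"
  msel :: "nat \<Rightarrow> real \<Rightarrow> nat"

definition valid_faces :: "nat \<Rightarrow> (nat \<Rightarrow> real) \<Rightarrow> real \<Rightarrow> real \<Rightarrow> bool" where
  "valid_faces N F a b \<longleftrightarrow> N \<ge> 1 \<and> F 0 = a \<and> F N = b \<and> (\<forall>i<N. F i < F (Suc i))"

definition side_selector ::
    "nat \<Rightarrow> (nat \<Rightarrow> real) \<Rightarrow> (nat \<Rightarrow> real \<Rightarrow> nat) \<Rightarrow> bool" where
  "side_selector N F sel \<longleftrightarrow>
     (\<forall>k\<in>{1..N}. \<forall>y\<in>{F 0..F N}.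
        sel k y \<in> {1..N} \<and> y \<in> {F (sel k y - 1)..F (sel k y)} \<and>
        (y \<in> {F (k - 1)..F k} \<longrightarrow> sel k y = k))"

definition cell :: "dg \<Rightarrow> nat \<Rightarrow> nat \<Rightarrow> nat \<Rightarrow> (real \<times> real \<times> real) set" where
  "cell S i k m = {xface S (i-1)..xface S i} \<times> {pface S (k-1)..pface S k}
                    \<times> {mface S (m-1)..mface S m}"

definition open_cell :: "dg \<Rightarrow> nat \<Rightarrow> nat \<Rightarrow> nat \<Rightarrow> (real \<times> real \<times> real) set" where
  "open_cell S i k m = {xface S (i-1)<..<xface S i} \<times> {pface S (k-1)<..<pface S k}
                    \<times> {mface S (m-1)<..<mface S m}"

definition piecewise_polynomial :: "dg \<Rightarrow> (real \<Rightarrow> real \<Rightarrow> real \<Rightarrow> real) \<Rightarrow> bool" where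
  "piecewise_polynomial S g \<longleftrightarrow>
     (\<forall>i\<in>{1..Nx S}. \<forall>k\<in>{1..Np S}. \<forall>m\<in>{1..Nm S}.
        \<exists>A :: nat \<Rightarrow> nat \<Rightarrow> nat \<Rightarrow> real. \<forall>(x, p, \<mu>)\<in>open_cell S i k m.
          g x p \<mu> = (\<Sum>a\<le>deg S. \<Sum>b\<le>deg S. \<Sum>c\<le>deg S. A a b c * x ^ a * p ^ b * \<mu> ^ c))"

text \<open>Smoothness up to the boundary: all derivatives exist on a neighbourhood.\<close>

definition smooth_near :: "real set \<Rightarrow> (real \<Rightarrow> real) \<Rightarrow> bool" where
  "smooth_near X g \<longleftrightarrow>
     (\<exists>U. open U \<and> X \<subseteq> U \<and> (\<forall>n. \<forall>y\<in>U. (deriv ^^ n) g differentiable (at y)))"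

text \<open>The requirement \<open>eps S 0 = 0\<close> is implicit in the cut-off to \<open>[0, \<epsilon>_max]\<close>, on which the
  inverse \<open>p(\<epsilon>)\<close> must be defined. Monotonicity is asked for on \<open>(0, p_max]\<close> only, so that the
  parabolic and Kane bands, for which the derivative vanishes at \<open>p = 0\<close>, are covered.\<close>

definition valid_dg :: "dg \<Rightarrow> bool" where
  "valid_dg S \<longleftrightarrow>
     valid_faces (Nx S) (xface S) 0 (Lx S) \<and>
     valid_faces (Np S) (pface S) 0 (pmax S) \<and>
     valid_faces (Nm S) (mface S) (-1) 1 \<and>
     (\<forall>t. piecewise_polynomial S (\<lambda>x p \<mu>. fh S x p \<mu> t)) \<and>
     smooth_near {0..pmax S} (eps S) \<and>
     eps S 0 = 0 \<and> (\<forall>p\<in>{0<..pmax S}. deriv (eps S) p > 0) \<and>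
     charge S > 0 \<and> hw S > 0 \<and>
     (\<forall>j\<in>{-1..1}. ccoef S j \<ge> 0) \<and>
     ccoef S 1 = (nph S + 1) * Kcoef S \<and> ccoef S (-1) = nph S * Kcoef S \<and>
     (\<forall>R\<in>{rule_x S, rule_p S, rule_m S}. gauss_rule R \<or> gauss_lobatto_rule R) \<and>
     positive_rule (rule_gain S) \<and> gauss_lobatto_rule (rule_GL S) \<and>
     side_selector (Np S) (pface S) (psel S) \<and> side_selector (Nm S) (mface S) (msel S)"

section \<open>Values, one-sided limits and cell averages\<close>

text \<open>Limit of \<open>f_h\<close> at a point of the closed cell from inside the cell; in the interior it is
  the value of \<open>f_h\<close>.\<close>

definition cell_lim :: "dg \<Rightarrow> nat \<Rightarrow> nat \<Rightarrow> nat \<Rightarrow> real \<Rightarrow> real \<Rightarrow> real \<Rightarrow> real \<Rightarrow> real" where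
  "cell_lim S i k m x p \<mu> t =
     Lim (at (x, p, \<mu>) within open_cell S i k m) (\<lambda>(x', p', \<mu>'). fh S x' p' \<mu>' t)"

text \<open>\<open>f_h\<close> as a function on column \<open>i\<close> as seen from the cell \<open>(i, k, m)\<close>.\<close>

definition fview :: "dg \<Rightarrow> nat \<Rightarrow> nat \<Rightarrow> nat \<Rightarrow> real \<Rightarrow> real \<Rightarrow> real \<Rightarrow> real \<Rightarrow> real" where
  "fview S i k m x p \<mu> t = cell_lim S i (psel S k p) (msel S m \<mu>) x p \<mu> t"

definition cell_volume :: "dg \<Rightarrow> nat \<Rightarrow> nat \<Rightarrow> nat \<Rightarrow> real" where
  "cell_volume S i k m = integral (cell S i k m) (\<lambda>(x, p, \<mu>). p\<^sup>2)"

definition cell_mass :: "dg \<Rightarrow> nat \<Rightarrow> nat \<Rightarrow> nat \<Rightarrow> real \<Rightarrow> real" where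
  "cell_mass S i k m t = integral (cell S i k m) (\<lambda>(x, p, \<mu>). fh S x p \<mu> t * p\<^sup>2)"

definition cell_avg :: "dg \<Rightarrow> nat \<Rightarrow> nat \<Rightarrow> nat \<Rightarrow> real \<Rightarrow> real" where
  "cell_avg S i k m t = cell_mass S i k m t / cell_volume S i k m"

text \<open>Limits from the smaller (\<open>lim_*_minus\<close>) and larger (\<open>lim_*_plus\<close>) side at the interface
  with index \<open>i\<close>, \<open>k\<close>, resp. \<open>m\<close>. No datum is needed outside \<open>p = 0\<close> and \<open>\<mu> = \<plusminus>1\<close>, because these
  faces enter the scheme with a factor \<open>p\<^sup>2 = 0\<close>, resp. \<open>1 - \<mu>\<^sup>2 = 0\<close>; the value 0 there is a
  placeholder.\<close>

definition lim_x_minus where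
  "lim_x_minus S i k m p \<mu> t =
     (if i = 0 then bd_x0 S p \<mu> t else cell_lim S i k m (xface S i) p \<mu> t)"

definition lim_x_plus where
  "lim_x_plus S i k m p \<mu> t =
     (if i = Nx S then bd_xL S p \<mu> t else cell_lim S (i + 1) k m (xface S i) p \<mu> t)"

definition lim_p_minus where
  "lim_p_minus S i k m x \<mu> t =
     (if k = 0 then 0 else cell_lim S i k m x (pface S k) \<mu> t)"

definition lim_p_plus where
  "lim_p_plus S i k m x \<mu> t =
     (if k = Np S then bd_pmax S x \<mu> t else cell_lim S i (k + 1) m x (pface S k) \<mu> t)"

definition lim_m_minus where
  "lim_m_minus S i k m x p t =
     (if m = 0 then 0 else cell_lim S i k m x p (mface S m) t)"

definition lim_m_plus where
  "lim_m_plus S i k m x p t =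
     (if m = Nm S then 0 else cell_lim S i k (m + 1) x p (mface S m) t)"

section \<open>Transport term\<close>

definition flux_x where
  "flux_x S i k m p \<mu> t = deriv (eps S) p *
     ((\<mu> + \<bar>\<mu>\<bar>) / 2 * lim_x_minus S i k m p \<mu> t + (\<mu> - \<bar>\<mu>\<bar>) / 2 * lim_x_plus S i k m p \<mu> t)"

definition flux_p where
  "flux_p S i k m x \<mu> t = charge S *
     ((- Efield S x t * \<mu> + \<bar>Efield S x t * \<mu>\<bar>) / 2 * lim_p_minus S i k m x \<mu> t
    + (- Efield S x t * \<mu> - \<bar>Efield S x t * \<mu>\<bar>) / 2 * lim_p_plus S i k m x \<mu> t)"

definition flux_m where
  "flux_m S i k m x p t = charge S *
     ((- Efield S x t + \<bar>Efield S x t\<bar>) / 2 * lim_m_minus S i k m x p t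
    + (- Efield S x t - \<bar>Efield S x t\<bar>) / 2 * lim_m_plus S i k m x p t)"

text \<open>Integration over the cell sides by the rules of the scheme.\<close>

definition int_x :: "dg \<Rightarrow> quadrule \<Rightarrow> nat \<Rightarrow> (real \<Rightarrow> real) \<Rightarrow> real" where
  "int_x S R i = qint R (xface S (i-1)) (xface S i)"

definition int_p :: "dg \<Rightarrow> quadrule \<Rightarrow> nat \<Rightarrow> (real \<Rightarrow> real) \<Rightarrow> real" where
  "int_p S R k = qint R (pface S (k-1)) (pface S k)"

definition int_m :: "dg \<Rightarrow> quadrule \<Rightarrow> nat \<Rightarrow> (real \<Rightarrow> real) \<Rightarrow> real" where
  "int_m S R m = qint R (mface S (m-1)) (mface S m)"

definition Gamma_T :: "dg \<Rightarrow> nat \<Rightarrow> nat \<Rightarrow> nat \<Rightarrow> real \<Rightarrow> real \<Rightarrow> real" where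
  "Gamma_T S i k m t dt = - (dt / cell_volume S i k m) *
     ( int_p S (rule_p S) k (\<lambda>p. int_m S (rule_m S) m (\<lambda>\<mu>.
          (flux_x S i k m p \<mu> t - flux_x S (i-1) k m p \<mu> t) * p\<^sup>2))
     + int_x S (rule_x S) i (\<lambda>x. int_m S (rule_m S) m (\<lambda>\<mu>.
          (pface S k)\<^sup>2 * flux_p S i k m x \<mu> t - (pface S (k-1))\<^sup>2 * flux_p S i (k-1) m x \<mu> t))
     + int_x S (rule_x S) i (\<lambda>x. int_p S (rule_p S) k (\<lambda>p.
          ((1 - (mface S m)\<^sup>2) * flux_m S i k m x p t
         - (1 - (mface S (m-1))\<^sup>2) * flux_m S i k (m-1) x p t) * p)))"

section \<open>Collision term\<close>

definition pinv :: "dg \<Rightarrow> real \<Rightarrow> real" where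
  "pinv S = the_inv_into {0..pmax S} (eps S)"

text \<open>The derivative is one-sided at the ends of \<open>[0, \<epsilon>_max]\<close>. If it is infinite at 0, it
  is multiplied by \<open>p\<^sup>2 = 0\<close> wherever it is used.\<close>

definition dp_deps :: "dg \<Rightarrow> real \<Rightarrow> real" where
  "dp_deps S e = vector_derivative (pinv S) (at e within {0..eps S (pmax S)})"

definition chi :: "dg \<Rightarrow> real \<Rightarrow> real" where
  "chi S e = indicator {0..eps S (pmax S)} e"

definition nu :: "dg \<Rightarrow> real \<Rightarrow> real" where
  "nu S p = 4 * pi * (\<Sum>j\<in>{-1..1}. ccoef S j *
     (let e = eps S p - of_int j * hw S in (pinv S e)\<^sup>2 * dp_deps S e * chi S e))"

text \<open>\<open>I\<close> is the integration functional for \<open>\<mu>'\<close>: \<open>integral {-1..1}\<close> gives the continuous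
  operator, a quadrature rule the one of the scheme.\<close>

definition collision ::
    "dg \<Rightarrow> ((real \<Rightarrow> real) \<Rightarrow> real) \<Rightarrow> (real \<Rightarrow> real \<Rightarrow> real \<Rightarrow> real \<Rightarrow> real)
      \<Rightarrow> real \<Rightarrow> real \<Rightarrow> real \<Rightarrow> real \<Rightarrow> real" where
  "collision S I f x p \<mu> t =
     2 * pi * (\<Sum>j\<in>{-1..1}. ccoef S j * I (\<lambda>\<mu>'.
        let e = eps S p + of_int j * hw S
        in f x (pinv S e) \<mu>' t * (pinv S e)\<^sup>2 * dp_deps S e * chi S e))
     - nu S p * f x p \<mu> t"

definition Qh :: "dg \<Rightarrow> nat \<Rightarrow> nat \<Rightarrow> nat \<Rightarrow> real \<Rightarrow> real \<Rightarrow> real \<Rightarrow> real \<Rightarrow> real" where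
  "Qh S i k m = collision S (qint (rule_gain S) (-1) 1) (fview S i k m)"

definition Gamma_C :: "dg \<Rightarrow> nat \<Rightarrow> nat \<Rightarrow> nat \<Rightarrow> real \<Rightarrow> real \<Rightarrow> real" where
  "Gamma_C S i k m t dt = dt / cell_volume S i k m *
     int_x S (rule_x S) i (\<lambda>x. int_p S (rule_p S) k (\<lambda>p. int_m S (rule_m S) m (\<lambda>\<mu>.
       Qh S i k m x p \<mu> t * p\<^sup>2)))"

section \<open>Quadrature points and exactness\<close>

definition xnodes :: "dg \<Rightarrow> quadrule \<Rightarrow> nat \<Rightarrow> real set" where
  "xnodes S R i = qnodes R (xface S (i-1)) (xface S i)"

definition pnodes :: "dg \<Rightarrow> quadrule \<Rightarrow> nat \<Rightarrow> real set" where
  "pnodes S R k = qnodes R (pface S (k-1)) (pface S k)"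

definition mnodes :: "dg \<Rightarrow> quadrule \<Rightarrow> nat \<Rightarrow> real set" where
  "mnodes S R m = qnodes R (mface S (m-1)) (mface S m)"

text \<open>The four tensor rules for cell integrals: the rule of the scheme, and those with the
  Gauss--Lobatto rule in one direction.\<close>

definition cell_rules :: "dg \<Rightarrow> (quadrule \<times> quadrule \<times> quadrule) set" where
  "cell_rules S =
     {(rule_x S, rule_p S, rule_m S), (rule_GL S, rule_p S, rule_m S),
      (rule_x S, rule_GL S, rule_m S), (rule_x S, rule_p S, rule_GL S)}"

definition exact_mass :: "dg \<Rightarrow> nat \<Rightarrow> nat \<Rightarrow> nat \<Rightarrow> real \<Rightarrow> bool" where
  "exact_mass S i k m t \<longleftrightarrow>
     (\<forall>(Rx, Rp, Rm)\<in>cell_rules S.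
        cell_mass S i k m t =
          int_x S Rx i (\<lambda>x. int_p S Rp k (\<lambda>p. int_m S Rm m (\<lambda>\<mu>. cell_lim S i k m x p \<mu> t * p\<^sup>2))))"

definition nonneg_in_cell :: "dg \<Rightarrow> nat \<Rightarrow> nat \<Rightarrow> nat \<Rightarrow> real \<Rightarrow> bool" where
  "nonneg_in_cell S i k m t \<longleftrightarrow>
     (\<forall>(Rx, Rp, Rm)\<in>cell_rules S.
        \<forall>x\<in>xnodes S Rx i. \<forall>p\<in>pnodes S Rp k. \<forall>\<mu>\<in>mnodes S Rm m. cell_lim S i k m x p \<mu> t \<ge> 0)"

definition nonneg_at_faces :: "dg \<Rightarrow> nat \<Rightarrow> nat \<Rightarrow> nat \<Rightarrow> real \<Rightarrow> bool" where
  "nonneg_at_faces S i k m t \<longleftrightarrow>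
     (\<forall>i'\<in>{i-1, i}. \<forall>p\<in>pnodes S (rule_p S) k. \<forall>\<mu>\<in>mnodes S (rule_m S) m.
        lim_x_minus S i' k m p \<mu> t \<ge> 0 \<and> lim_x_plus S i' k m p \<mu> t \<ge> 0) \<and>
     (\<forall>k'\<in>{k-1, k}. \<forall>x\<in>xnodes S (rule_x S) i. \<forall>\<mu>\<in>mnodes S (rule_m S) m.
        lim_p_minus S i k' m x \<mu> t \<ge> 0 \<and> lim_p_plus S i k' m x \<mu> t \<ge> 0) \<and>
     (\<forall>m'\<in>{m-1, m}. \<forall>x\<in>xnodes S (rule_x S) i. \<forall>p\<in>pnodes S (rule_p S) k.
        lim_m_minus S i k m' x p t \<ge> 0 \<and> lim_m_plus S i k m' x p t \<ge> 0)"

definition nonneg_at_gain_points :: "dg \<Rightarrow> nat \<Rightarrow> nat \<Rightarrow> nat \<Rightarrow> real \<Rightarrow> bool" where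
  "nonneg_at_gain_points S i k m t \<longleftrightarrow>
     (\<forall>x\<in>xnodes S (rule_x S) i. \<forall>p\<in>pnodes S (rule_p S) k. \<forall>\<mu>'\<in>qnodes (rule_gain S) (-1) 1.
        \<forall>j\<in>{-1..1::int}. eps S p + of_int j * hw S \<in> {0..eps S (pmax S)} \<longrightarrow>
          fview S i k m x (pinv S (eps S p + of_int j * hw S)) \<mu>' t \<ge> 0)"

definition negQ_points ::
    "dg \<Rightarrow> nat \<Rightarrow> nat \<Rightarrow> nat \<Rightarrow> real \<Rightarrow> (real \<times> real \<times> real) set" where
  "negQ_points S i k m t =
     {(x, p, \<mu>). x \<in> xnodes S (rule_x S) i \<and> p \<in> pnodes S (rule_p S) k \<and>
        \<mu> \<in> mnodes S (rule_m S) m \<and> Qh S i k m x p \<mu> t < 0}"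

end

theory Submission
  imports Defs
begin

text \<open>The average is split as \<open>\<alpha>\<close> times a transport part plus \<open>1 - \<alpha>\<close> times a collision part.
  In the transport part the cell mass is split once more with weights \<open>s1, s2, s3\<close>, and the share
  of each direction is written with the Gauss--Lobatto rule in that direction: its endpoint terms
  alone absorb the outflow through the two faces, while the upwind inflow is non-negative. In the
  collision part the integrand is non-negative at each node of the tensor rule.\<close>

section \<open>Quadrature\<close>

text \<open>The threefold split rests on \<open>exact_mass\<close>: one number,
  \<open>cell_mass\<close>, equals several finite sums, so each direction may use the sum that has
  its own two faces among the nodes. After that only finite sums with positive weights are compared.
  A share \<open>C\<close> of the mass (\<alpha> * s1 and so on) leaves at each face the weight
  \<open>C\<close> times the endpoint weight times the side length, and the CFL condition makes this
  at least dt times the outflow speed. The point p = 0 shapes the details. The mass has density p^2.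
  The x- and p-fluxes carry the same factor, but the \<mu>-flux only p; the missing power is the
  origin of \<open>pface S (k-1)\<close> in the third CFL condition. The slope of the band may
  vanish at p = 0, and the inverse band then has no finite derivative there; a factor p^2 removes
  the term in question, so p = 0 is treated apart.\<close>

lemma qint_mono:
  assumes "positive_rule R" "a \<le> b" "\<And>y. y \<in> qnodes R a b \<Longrightarrow> f y \<le> g y"
  shows "qint R a b f \<le> qint R a b g"
  using assms unfolding qint_def positive_rule_def qnodes_def
  by (intro mult_left_mono sum_mono) (auto intro!: mult_left_mono simp: less_imp_le)

lemma qint_nonneg:
  assumes "positive_rule R" "a \<le> b" "\<And>y. y \<in> qnodes R a b \<Longrightarrow> 0 \<le> f y"
  shows "0 \<le> qint R a b f"
  using qint_mono[OF assms(1,2), of "\<lambda>_. 0" f] assms(3) by (simp add: qint_def)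

lemma qint_add: "qint R a b (\<lambda>y. f y + g y) = qint R a b f + qint R a b g"
  unfolding qint_def by (simp add: sum.distrib distrib_left)

lemma qint_cmult: "qint R a b (\<lambda>y. c * f y) = c * qint R a b f"
  unfolding qint_def by (simp add: sum_distrib_left mult_ac)

lemma qnodes_subset:
  assumes "positive_rule R" "a \<le> b"
  shows "qnodes R a b \<subseteq> {a..b}"
proof
  fix y assume "y \<in> qnodes R a b"
  then obtain l where l: "node R l \<in> {0..1}" "y = a + (b - a) * node R l"
    using assms(1) unfolding qnodes_def positive_rule_def by auto
  have "(b - a) * node R l \<le> (b - a) * 1"
    using assms(2) l(1) by (intro mult_left_mono) auto
  then show "y \<in> {a..b}"
    using l assms(2) by auto
qed

lemma finite_qnodes [simp]: "finite (qnodes R a b)"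
  unfolding qnodes_def by simp

lemma gauss_lobatto_endpoints:
  assumes "gauss_lobatto_rule G"
  shows "a \<in> qnodes G a b" "b \<in> qnodes G a b"
proof -
  have N: "0 < npts G" "npts G - 1 < npts G" and ends: "node G 0 = 0" "node G (npts G - 1) = 1"
    using assms unfolding gauss_lobatto_rule_def by auto
  show "a \<in> qnodes G a b"
    unfolding qnodes_def using N ends by (intro image_eqI[of _ _ 0]) simp_all
  show "b \<in> qnodes G a b"
    unfolding qnodes_def using N ends by (intro image_eqI[of _ _ "npts G - 1"]) simp_all
qed

text \<open>Interior nodes contribute non-negative terms and are dropped. The two endpoint weights
  agree, so a single constant serves both faces.\<close>

lemma gauss_lobatto_ge_endpoints:
  assumes G: "gauss_lobatto_rule G" and "a \<le> b"
    and nonneg: "\<And>y. y \<in> qnodes G a b \<Longrightarrow> 0 \<le> f y"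
  shows "weight G (npts G - 1) * (b - a) * (f a + f b) \<le> qint G a b f"
proof -
  let ?N = "npts G" and ?h = "\<lambda>l. weight G l * f (a + (b - a) * node G l)"
  have N: "?N \<ge> 2" and ends: "node G 0 = 0" "node G (?N - 1) = 1" "weight G 0 = weight G (?N - 1)"
    and pos: "\<And>l. l < ?N \<Longrightarrow> weight G l > 0"
    using G unfolding gauss_lobatto_rule_def positive_rule_def by auto
  \<comment> \<open>With at least two nodes the indices 0 and \<open>?N - 1\<close> differ, so both
    endpoint terms are present in the left sum.\<close>
  have "sum ?h {0, ?N - 1} \<le> sum ?h {..<?N}"
    using N nonneg pos
    by (intro sum_mono2 mult_nonneg_nonneg) (auto simp: qnodes_def less_imp_le)
  then have "weight G (?N - 1) * (f a + f b) \<le> sum ?h {..<?N}"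
    using N ends by (simp add: distrib_left)
  then have "(b - a) * (weight G (?N - 1) * (f a + f b)) \<le> (b - a) * sum ?h {..<?N}"
    using \<open>a \<le> b\<close> by (intro mult_left_mono) auto
  then show ?thesis
    unfolding qint_def by (simp add: mult_ac)
qed

text \<open>Form in which the endpoint bound meets a CFL condition: \<open>C\<close> is the share of
  the mass, \<open>J\<close> an outflow, and the last assumption is the bound of \<open>J\<close> by
  the face values.\<close>

lemma gauss_lobatto_dominates:
  assumes "gauss_lobatto_rule G" "a \<le> b" "0 \<le> C"
    and "\<And>y. y \<in> qnodes G a b \<Longrightarrow> 0 \<le> f y"
    and "J \<le> C * (weight G (npts G - 1) * (b - a)) * (f a + f b)"
  shows "J \<le> C * qint G a b f"
proof -
  have "C * (weight G (npts G - 1) * (b - a) * (f a + f b)) \<le> C * qint G a b f"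
    using gauss_lobatto_ge_endpoints[of G a b f] assms(1-4) by (intro mult_left_mono) auto
  then show ?thesis
    using assms(5) by (simp add: mult_ac)
qed

text \<open>\<open>exact_mass\<close> fixes the order of the nested sums as x, p, \<mu>. The two
  variants for the position of the Gauss--Lobatto rule avoid any exchange of sums; this one serves
  the \<mu>-direction, where the bound applies separately at each face node.\<close>

lemma gauss_lobatto_dominates_inner:
  assumes G: "gauss_lobatto_rule G" "a \<le> b" and R: "positive_rule R" "a' \<le> b'" and C: "0 \<le> C"
    and nonneg: "\<And>y z. y \<in> qnodes R a' b' \<Longrightarrow> z \<in> qnodes G a b \<Longrightarrow> 0 \<le> f y z"
    and J: "\<And>y. y \<in> qnodes R a' b' \<Longrightarrow>
      J y \<le> C * (weight G (npts G - 1) * (b - a)) * (f y a + f y b)"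
  shows "qint R a' b' J \<le> C * qint R a' b' (\<lambda>y. qint G a b (f y))"
proof -
  have "qint R a' b' J \<le> qint R a' b' (\<lambda>y. C * qint G a b (f y))"
    using J nonneg by (intro qint_mono R gauss_lobatto_dominates G C) auto
  then show ?thesis
    by (simp add: qint_cmult)
qed

text \<open>For the x- and p-directions, whose rule lies outside a face rule: the pointwise bound on
  \<open>J\<close> is summed over the face first, and the endpoint bound is then applied to the face
  sums as functions of the outer variable.\<close>

lemma gauss_lobatto_dominates_outer:
  assumes G: "gauss_lobatto_rule G" "a \<le> b" and R: "positive_rule R" "a' \<le> b'" and C: "0 \<le> C"
    and nonneg: "\<And>y z. y \<in> qnodes R a' b' \<Longrightarrow> z \<in> qnodes G a b \<Longrightarrow> 0 \<le> f z y"
    and J: "\<And>y. y \<in> qnodes R a' b' \<Longrightarrow>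
      J y \<le> C * (weight G (npts G - 1) * (b - a)) * (f a y + f b y)"
  shows "qint R a' b' J \<le> C * qint G a b (\<lambda>z. qint R a' b' (f z))"
proof (rule gauss_lobatto_dominates[OF G C])
  show "0 \<le> qint R a' b' (f z)" if "z \<in> qnodes G a b" for z
    using nonneg that by (intro qint_nonneg R) auto
  have "qint R a' b' J
      \<le> qint R a' b' (\<lambda>y. C * (weight G (npts G - 1) * (b - a)) * (f a y + f b y))"
    using J by (intro qint_mono R) auto
  then show "qint R a' b' J
      \<le> C * (weight G (npts G - 1) * (b - a)) * (qint R a' b' (f a) + qint R a' b' (f b))"
    by (simp only: qint_cmult qint_add)
qed

section \<open>Upwind fluxes\<close>

text \<open>\<open>A0\<close> and \<open>A1\<close> are the limits from inside the cell at its lower and upper face, \<open>B0\<close> and \<open>B1\<close>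
  those from outside. Only the outflow has to be compensated.\<close>

lemma upwind_outflow_le:
  fixes v :: real
  assumes "0 \<le> w0" "0 \<le> w1" "0 \<le> A0" "0 \<le> A1" "0 \<le> B0" "0 \<le> B1"
  shows "w1 * ((v + \<bar>v\<bar>) / 2 * A1 + (v - \<bar>v\<bar>) / 2 * B1)
       - w0 * ((v + \<bar>v\<bar>) / 2 * B0 + (v - \<bar>v\<bar>) / 2 * A0) \<le> \<bar>v\<bar> * (w0 * A0 + w1 * A1)"
proof (cases "0 \<le> v")
  case True
  \<comment> \<open>The outflow term with \<open>A1\<close> occurs on both sides; what remains is
    the inflow \<open>B0\<close> and the endpoint value \<open>A0\<close>, each with a favourable
    sign.\<close>
  then have "0 \<le> v * (w0 * A0)" "0 \<le> v * (w0 * B0)"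
    using assms by simp_all
  then show ?thesis
    using True by (simp add: algebra_simps)
next
  case False
  then have "v * (w1 * A1) \<le> 0" "v * (w1 * B1) \<le> 0"
    using assms by (auto intro!: mult_nonpos_nonneg)
  then show ?thesis
    using False by (simp add: algebra_simps)
qed

section \<open>The energy band and its inverse\<close>

lemma valid_faces_mono:
  assumes "valid_faces N F a b" "i \<le> j" "j \<le> N"
  shows "F i \<le> F j"
  using assms(2,3)
proof (induction j rule: dec_induct)
  case (step j)
  moreover have "F j < F (Suc j)"
    using assms(1) step by (simp add: valid_faces_def)
  ultimately show ?case by simp
qed simp

lemma valid_faces_cell:
  assumes "valid_faces N F a b" "i \<in> {1..N}"
  shows "F (i-1) < F i" "a \<le> F (i-1)" "F i \<le> b"
proof -
  show "F (i-1) < F i"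
    using assms unfolding valid_faces_def by (cases i) auto
  show "a \<le> F (i-1)" "F i \<le> b"
    using valid_faces_mono[OF assms(1), of 0 "i-1"] valid_faces_mono[OF assms(1), of i N] assms
    by (auto simp: valid_faces_def)
qed

lemma pmax_pos:
  assumes "valid_dg S"
  shows "0 < pmax S"
proof -
  have F: "valid_faces (Np S) (pface S) 0 (pmax S)"
    using assms by (simp add: valid_dg_def)
  then have "1 \<in> {1..Np S}"
    by (simp add: valid_faces_def)
  from valid_faces_cell[OF F this] show ?thesis by simp
qed

lemma eps_has_derivative:
  assumes "valid_dg S" "p \<in> {0..pmax S}"
  shows "(eps S has_real_derivative deriv (eps S) p) (at p)"
proof -
  obtain U where "{0..pmax S} \<subseteq> U" "\<forall>n. \<forall>y\<in>U. (deriv ^^ n) (eps S) differentiable (at y)"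
    using assms(1) unfolding valid_dg_def smooth_near_def by blast
  then have "((deriv ^^ 0) (eps S)) differentiable (at p)"
    using assms(2) by blast
  then show ?thesis
    by (simp add: DERIV_deriv_iff_real_differentiable)
qed

lemma eps_continuous_on:
  assumes "valid_dg S"
  shows "continuous_on {0..pmax S} (eps S)"
  using eps_has_derivative[OF assms] by (meson DERIV_isCont continuous_at_imp_continuous_on)

text \<open>A positive derivative strictly inside suffices together with continuity, so a vanishing
  slope at p = 0 does no harm.\<close>

lemma eps_strict_mono_on:
  assumes "valid_dg S"
  shows "strict_mono_on {0..pmax S} (eps S)"
proof (rule strict_mono_onI)
  fix a b assume ab: "a \<in> {0..pmax S}" "b \<in> {0..pmax S}" "a < b"
  show "eps S a < eps S b"
  proof (rule DERIV_pos_imp_increasing_open[OF \<open>a < b\<close>])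
    show "\<exists>y. (eps S has_real_derivative y) (at x) \<and> 0 < y" if "a < x" "x < b" for x
    proof -
      have "0 < deriv (eps S) x" "x \<in> {0..pmax S}"
        using that ab assms unfolding valid_dg_def by auto
      then show ?thesis
        using eps_has_derivative[OF assms] by blast
    qed
    show "continuous_on {a..b} (eps S)"
      using eps_continuous_on[OF assms] ab by (elim continuous_on_subset) auto
  qed
qed

text \<open>Surjectivity is the intermediate value theorem with \<open>eps S 0 = 0\<close>. It
  identifies the domain of \<open>pinv\<close> with the support of \<open>chi\<close> and with the
  interval within which \<open>dp_deps\<close> differentiates.\<close>

lemma eps_image:
  assumes "valid_dg S"
  shows "eps S ` {0..pmax S} = {0..eps S (pmax S)}"
proof
  have "eps S 0 = 0"
    using assms by (simp add: valid_dg_def)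
  then show "{0..eps S (pmax S)} \<subseteq> eps S ` {0..pmax S}"
    using IVT'[of "eps S" 0 _ "pmax S"] pmax_pos[OF assms] eps_continuous_on[OF assms] by force
  have "eps S 0 \<le> eps S p \<and> eps S p \<le> eps S (pmax S)" if "p \<in> {0..pmax S}" for p
    using strict_mono_on_leD[OF eps_strict_mono_on[OF assms]] that by auto
  then show "eps S ` {0..pmax S} \<subseteq> {0..eps S (pmax S)}"
    using \<open>eps S 0 = 0\<close> by auto
qed

lemma pinv_eps:
  assumes "valid_dg S" "p \<in> {0..pmax S}"
  shows "pinv S (eps S p) = p"
  unfolding pinv_def
  by (intro the_inv_into_f_f strict_mono_on_imp_inj_on eps_strict_mono_on assms)

text \<open>The derivative of the inverse is the reciprocal slope. It is taken within the closed
  interval because p = \<open>pmax S\<close> admits only a one-sided derivative; p = 0 is excluded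
  because the slope may vanish there.\<close>

lemma dp_deps_nonneg:
  assumes S: "valid_dg S" and p: "p \<in> {0<..pmax S}"
  shows "0 \<le> dp_deps S (eps S p)"
proof -
  let ?D = "deriv (eps S) p" and ?e = "eps S (pmax S)"
  have D: "0 < ?D" and p': "p \<in> {0..pmax S}"
    using S p by (auto simp: valid_dg_def)
  have "(eps S has_derivative (\<lambda>h. ?D * h)) (at p within {0..pmax S})"
    using eps_has_derivative[OF S p'] by (simp add: has_field_derivative_def has_derivative_at_withinI)
  moreover have "continuous_on (eps S ` {0..pmax S}) (pinv S)"
    using pinv_eps[OF S] eps_continuous_on[OF S] by (intro continuous_on_inv) auto
  moreover have "eps S p \<in> eps S ` {0..pmax S}"
    using p' by blast
  moreover have "linear (\<lambda>h. h / ?D)"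
    by (intro bounded_linear.linear bounded_linear_divide)
  ultimately have "(pinv S has_derivative (\<lambda>h. h / ?D)) (at (eps S p) within eps S ` {0..pmax S})"
    using p' D pinv_eps[OF S]
    by (intro has_derivative_inverse_within) (auto simp: continuous_on_eq_continuous_within)
  then have "(pinv S has_vector_derivative 1 / ?D) (at (eps S p) within {0..?e})"
    unfolding eps_image[OF S] has_vector_derivative_def by simp
  moreover have "eps S p \<in> {0..?e}"
    using eps_image[OF S] p' by blast
  moreover have "0 < ?e"
    using strict_mono_onD[OF eps_strict_mono_on[OF S], of 0 "pmax S"] S pmax_pos[OF S]
    by (simp add: valid_dg_def)
  \<comment> \<open>Uniqueness of the derivative within an interval requires it to be
    non-degenerate, hence \<open>0 < ?e\<close>.\<close>
  ultimately have "dp_deps S (eps S p) = 1 / ?D"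
    unfolding dp_deps_def by (intro vector_derivative_within_closed_interval)
  then show ?thesis
    using D by simp
qed

text \<open>At e = 0 nothing is known about \<open>dp_deps\<close>, but the factor
  \<open>(pinv S e)\<^sup>2\<close> is 0.\<close>

lemma gain_factor_nonneg:
  assumes S: "valid_dg S" and "e \<in> {0..eps S (pmax S)}"
  shows "0 \<le> (pinv S e)\<^sup>2 * dp_deps S e"
proof -
  obtain p where p: "p \<in> {0..pmax S}" "e = eps S p"
    using assms(2) unfolding eps_image[OF S, symmetric] by blast
  show ?thesis
  proof (cases "p = 0")
    case True
    then show ?thesis
      using p pinv_eps[OF S, of p] by simp
  next
    case False
    then show ?thesis
      using p dp_deps_nonneg[OF S, of p] by simp
  qed
qed

section \<open>The collision integrand\<close>

lemma valid_dg_rules: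
  assumes "valid_dg S"
  shows "positive_rule (rule_x S)" "positive_rule (rule_p S)" "positive_rule (rule_m S)"
    "positive_rule (rule_gain S)" "gauss_lobatto_rule (rule_GL S)"
  using assms unfolding valid_dg_def gauss_rule_def gauss_lobatto_rule_def by auto

lemma valid_dg_faces:
  assumes "valid_dg S"
  shows "valid_faces (Nx S) (xface S) 0 (Lx S)" "valid_faces (Np S) (pface S) 0 (pmax S)"
    "valid_faces (Nm S) (mface S) (-1) 1"
  using assms unfolding valid_dg_def by auto

lemma node_in_cell:
  assumes S: "valid_dg S" and ikm: "i \<in> {1..Nx S}" "k \<in> {1..Np S}" "m \<in> {1..Nm S}"
  shows "positive_rule R \<Longrightarrow> x \<in> xnodes S R i \<Longrightarrow> x \<in> {xface S (i-1)..xface S i}"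
    and "positive_rule R \<Longrightarrow> p \<in> pnodes S R k \<Longrightarrow> p \<in> {pface S (k-1)..pface S k}"
    and "positive_rule R \<Longrightarrow> \<mu> \<in> mnodes S R m \<Longrightarrow> \<mu> \<in> {mface S (m-1)..mface S m}"
  using qnodes_subset[of R] valid_faces_cell(1)[OF valid_dg_faces(1)[OF S] ikm(1)]
    valid_faces_cell(1)[OF valid_dg_faces(2)[OF S] ikm(2)]
    valid_faces_cell(1)[OF valid_dg_faces(3)[OF S] ikm(3)]
  unfolding xnodes_def pnodes_def mnodes_def by (meson less_imp_le subsetD)+

lemma side_selector_own_cell:
  assumes F: "valid_faces N F a b" and "side_selector N F sel" "k \<in> {1..N}" "y \<in> {F (k-1)..F k}"
  shows "sel k y = k"
proof -
  have "y \<in> {F 0..F N}"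
    using valid_faces_cell[OF F \<open>k \<in> {1..N}\<close>] F assms(4) by (auto simp: valid_faces_def)
  then show ?thesis
    using assms unfolding side_selector_def by blast
qed

text \<open>\<open>collision\<close> uses one function for gain and loss, namely
  \<open>fview\<close>. In the loss term the point lies in the closed cell, where the selectors
  choose this cell even on a shared face.\<close>

lemma fview_own_cell:
  assumes S: "valid_dg S" and "k \<in> {1..Np S}" "m \<in> {1..Nm S}"
    and "p \<in> {pface S (k-1)..pface S k}" "\<mu> \<in> {mface S (m-1)..mface S m}"
  shows "fview S i k m x p \<mu> t = cell_lim S i k m x p \<mu> t"
proof -
  have "side_selector (Np S) (pface S) (psel S)" "side_selector (Nm S) (mface S) (msel S)"
    using S unfolding valid_dg_def by auto
  then have "psel S k p = k" "msel S m \<mu> = m"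
    using side_selector_own_cell valid_dg_faces[OF S] assms by blast+
  then show ?thesis
    by (simp add: fview_def)
qed

text \<open>The gain is a sum of non-negative terms and is discarded. This is the use of the extra
  sign condition in (C1).\<close>

lemma Qh_ge_loss:
  assumes S: "valid_dg S" and ikm: "k \<in> {1..Np S}" "m \<in> {1..Nm S}"
    and gain: "nonneg_at_gain_points S i k m t"
    and nodes: "x \<in> xnodes S (rule_x S) i" "p \<in> pnodes S (rule_p S) k"
    and cell: "p \<in> {pface S (k-1)..pface S k}" "\<mu> \<in> {mface S (m-1)..mface S m}"
  shows "- nu S p * cell_lim S i k m x p \<mu> t \<le> Qh S i k m x p \<mu> t"
proof -
  define g where "g j \<mu>' = (let e = eps S p + of_int j * hw S
    in fview S i k m x (pinv S e) \<mu>' t * (pinv S e)\<^sup>2 * dp_deps S e * chi S e)" for j :: int and \<mu>'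
  have g: "0 \<le> g j \<mu>'" if "j \<in> {-1..1}" "\<mu>' \<in> qnodes (rule_gain S) (-1) 1" for j \<mu>'
  \<comment> \<open>Outside this range \<open>pinv\<close> is unspecified, but \<open>chi\<close>
    vanishes.\<close>
  proof (cases "eps S p + of_int j * hw S \<in> {0..eps S (pmax S)}")
    case True
    then have "0 \<le> fview S i k m x (pinv S (eps S p + of_int j * hw S)) \<mu>' t"
      using gain nodes that unfolding nonneg_at_gain_points_def by blast
    from mult_nonneg_nonneg[OF this gain_factor_nonneg[OF S True]] show ?thesis
      using True by (simp add: g_def chi_def Let_def mult.assoc)
  qed (simp add: g_def chi_def Let_def)
  have c: "\<And>j. j \<in> {-1..1} \<Longrightarrow> 0 \<le> ccoef S j"
    using S by (simp add: valid_dg_def)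
  have "0 \<le> 2 * pi * (\<Sum>j\<in>{-1..1}. ccoef S j * qint (rule_gain S) (-1) 1 (g j))"
    using g c valid_dg_rules(4)[OF S]
    by (intro mult_nonneg_nonneg sum_nonneg qint_nonneg) auto
  then show ?thesis
    unfolding Qh_def collision_def g_def fview_own_cell[OF S ikm cell] by simp
qed

text \<open>Here \<beta> stands for 1 - \<alpha>. Under (C1) the loss bound gives at least (\<beta>
  - dt * \<open>nu S p\<close>) times the value of \<open>f_h\<close>. Under (C2) only nodes with
  negative \<open>Qh\<close> matter, and there dt * |Q| is at most \<beta> times that value.\<close>

lemma collision_integrand_nonneg:
  assumes S: "valid_dg S" and ikm: "i \<in> {1..Nx S}" "k \<in> {1..Np S}" "m \<in> {1..Nm S}"
    and "0 < dt" and \<beta>: "0 < \<beta>"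
    and f: "0 \<le> cell_lim S i k m x p \<mu> t"
    and nodes: "x \<in> xnodes S (rule_x S) i" "p \<in> pnodes S (rule_p S) k"
      "\<mu> \<in> mnodes S (rule_m S) m"
    and collision_condition:
      "(nonneg_at_gain_points S i k m t \<and> dt * Max (nu S ` pnodes S (rule_p S) k) < \<beta>) \<or>
       (negQ_points S i k m t \<noteq> {} \<longrightarrow>
          dt \<le> \<beta> * Min ((\<lambda>(x, p, \<mu>). cell_lim S i k m x p \<mu> t
                    / \<bar>Qh S i k m x p \<mu> t\<bar>) ` negQ_points S i k m t))"
  shows "0 \<le> \<beta> * cell_lim S i k m x p \<mu> t + dt * Qh S i k m x p \<mu> t"
  using collision_condition
proof
  let ?f = "cell_lim S i k m x p \<mu> t" and ?Q = "Qh S i k m x p \<mu> t"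
  assume C1: "nonneg_at_gain_points S i k m t \<and> dt * Max (nu S ` pnodes S (rule_p S) k) < \<beta>"
  have "- nu S p * ?f \<le> ?Q"
    using Qh_ge_loss[OF S ikm(2,3)] C1 nodes node_in_cell[OF S ikm] valid_dg_rules[OF S] by blast
  then have "dt * (- nu S p * ?f) \<le> dt * ?Q"
    using \<open>0 < dt\<close> by (intro mult_left_mono) auto
  moreover have "nu S p \<le> Max (nu S ` pnodes S (rule_p S) k)"
    using nodes by (intro Max_ge) (auto simp: pnodes_def)
  then have "dt * nu S p \<le> \<beta>"
    using C1 \<open>0 < dt\<close> by (smt (verit) mult_left_mono)
  from mult_right_mono[OF this f] have "dt * nu S p * ?f \<le> \<beta> * ?f" .
  ultimately show ?thesis
    by (simp add: mult.assoc)
next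
  let ?f = "cell_lim S i k m x p \<mu> t" and ?Q = "Qh S i k m x p \<mu> t"
  let ?r = "\<lambda>(x, p, \<mu>). cell_lim S i k m x p \<mu> t / \<bar>Qh S i k m x p \<mu> t\<bar>"
  assume C2: "negQ_points S i k m t \<noteq> {} \<longrightarrow> dt \<le> \<beta> * Min (?r ` negQ_points S i k m t)"
  show ?thesis
  proof (cases "?Q < 0")
    case True
    then have mem: "(x, p, \<mu>) \<in> negQ_points S i k m t"
      using nodes by (simp add: negQ_points_def)
    \<comment> \<open>Finiteness is what makes \<open>Min\<close> a lower bound.\<close>
    have "negQ_points S i k m t
        \<subseteq> xnodes S (rule_x S) i \<times> pnodes S (rule_p S) k \<times> mnodes S (rule_m S) m"
      by (auto simp: negQ_points_def)
    then have "finite (negQ_points S i k m t)"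
      by (rule finite_subset) (simp add: xnodes_def pnodes_def mnodes_def)
    then have "Min (?r ` negQ_points S i k m t) \<le> ?f / \<bar>?Q\<bar>"
      using mem by (intro Min_le) (auto intro: rev_image_eqI)
    then have "\<beta> * Min (?r ` negQ_points S i k m t) \<le> \<beta> * (?f / \<bar>?Q\<bar>)"
      using \<beta> by (intro mult_left_mono) auto
    then have "dt \<le> \<beta> * (?f / \<bar>?Q\<bar>)"
      using C2 mem by auto
    then show ?thesis
      using True by (simp add: field_simps)
  next
    case False
    then show ?thesis
      using f \<beta> \<open>0 < dt\<close> by simp
  qed
qed

section \<open>Positivity of the two parts\<close>

text \<open>The sign is all that the divisions by the volume use. The integral of a non-integrable
  function is 0 by convention, so a case split settles integrability.\<close>

lemma cell_volume_nonneg: "0 \<le> cell_volume S i k m"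
  unfolding cell_volume_def
  by (cases "(\<lambda>(x, p, \<mu>). p\<^sup>2) integrable_on cell S i k m")
    (auto intro!: integral_nonneg simp: not_integrable_integral)

text \<open>The tensor rule that evaluates \<open>Gamma_C\<close> is also exact for the mass, so
  both become one sum over the same nodes, to which the nodewise bound applies.\<close>

lemma collision_part_nonneg:
  assumes S: "valid_dg S" and ikm: "i \<in> {1..Nx S}" "k \<in> {1..Np S}" "m \<in> {1..Nm S}"
    and dt: "0 < dt" and \<beta>: "0 < \<beta>"
    and exact: "exact_mass S i k m t" and nonneg: "nonneg_in_cell S i k m t"
    and collision_condition:
      "(nonneg_at_gain_points S i k m t \<and> dt * Max (nu S ` pnodes S (rule_p S) k) < \<beta>) \<or>
       (negQ_points S i k m t \<noteq> {} \<longrightarrow>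
          dt \<le> \<beta> * Min ((\<lambda>(x, p, \<mu>). cell_lim S i k m x p \<mu> t
                    / \<bar>Qh S i k m x p \<mu> t\<bar>) ` negQ_points S i k m t))"
  shows "0 \<le> cell_avg S i k m t + Gamma_C S i k m t dt / \<beta>"
proof -
  define I where "I f = int_x S (rule_x S) i (\<lambda>x. int_p S (rule_p S) k (\<lambda>p.
    int_m S (rule_m S) m (\<lambda>\<mu>. f x p \<mu>)))" for f
  let ?f = "\<lambda>x p \<mu>. cell_lim S i k m x p \<mu> t" and ?Q = "\<lambda>x p \<mu>. Qh S i k m x p \<mu> t"
  have mass: "cell_mass S i k m t = I (\<lambda>x p \<mu>. ?f x p \<mu> * p\<^sup>2)"
    using exact unfolding exact_mass_def cell_rules_def I_def by auto
  have lin: "I (\<lambda>x p \<mu>. c * f x p \<mu> + d * g x p \<mu>) = c * I f + d * I g" for c d f g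
    unfolding I_def int_x_def int_p_def int_m_def by (simp add: qint_add qint_cmult)
  note le = valid_faces_cell(1)[OF valid_dg_faces(1)[OF S] ikm(1), THEN less_imp_le]
    valid_faces_cell(1)[OF valid_dg_faces(2)[OF S] ikm(2), THEN less_imp_le]
    valid_faces_cell(1)[OF valid_dg_faces(3)[OF S] ikm(3), THEN less_imp_le]
  have "0 \<le> \<beta> * (?f x p \<mu> * p\<^sup>2) + dt * (?Q x p \<mu> * p\<^sup>2)"
    if nodes: "x \<in> xnodes S (rule_x S) i" "p \<in> pnodes S (rule_p S) k" "\<mu> \<in> mnodes S (rule_m S) m"
    for x p \<mu>
  proof -
    have "0 \<le> ?f x p \<mu>"
      using nonneg nodes unfolding nonneg_in_cell_def cell_rules_def by auto
    from collision_integrand_nonneg[OF S ikm dt \<beta> this nodes collision_condition]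
    have "0 \<le> (\<beta> * ?f x p \<mu> + dt * ?Q x p \<mu>) * p\<^sup>2"
      by simp
    then show ?thesis
      by (simp add: algebra_simps)
  qed
  then have "0 \<le> I (\<lambda>x p \<mu>. \<beta> * (?f x p \<mu> * p\<^sup>2) + dt * (?Q x p \<mu> * p\<^sup>2))"
    unfolding I_def int_x_def int_p_def int_m_def xnodes_def pnodes_def mnodes_def
    by (intro qint_nonneg valid_dg_rules[OF S] le) auto
  then have "0 \<le> (\<beta> * cell_mass S i k m t + dt * I (\<lambda>x p \<mu>. ?Q x p \<mu> * p\<^sup>2))
      / (\<beta> * cell_volume S i k m)"
    using cell_volume_nonneg[of S i k m] \<beta> unfolding lin mass by simp
  also have "\<dots> = cell_avg S i k m t + Gamma_C S i k m t dt / \<beta>"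
    using \<beta> unfolding cell_avg_def Gamma_C_def I_def by (simp add: add_divide_distrib)
  finally show ?thesis .
qed

text \<open>Used with \<open>C\<close> = \<alpha> * s1. The upwind bound is taken with speed \<mu>
  and the band slope as weight at both faces.\<close>

lemma transport_x_le:
  assumes S: "valid_dg S" and ikm: "i \<in> {1..Nx S}" "k \<in> {1..Np S}" "m \<in> {1..Nm S}"
    and dt: "0 < dt" and C: "0 \<le> C"
    and exact: "exact_mass S i k m t"
    and nonneg: "nonneg_in_cell S i k m t" "nonneg_at_faces S i k m t"
    and cfl: "dt * Max (deriv (eps S) ` pnodes S (rule_p S) k) * max \<bar>mface S (m-1)\<bar> \<bar>mface S m\<bar>
        \<le> C * (weight (rule_GL S) (npts (rule_GL S) - 1) * (xface S i - xface S (i-1)))"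
  shows "dt * int_p S (rule_p S) k (\<lambda>p. int_m S (rule_m S) m (\<lambda>\<mu>.
          (flux_x S i k m p \<mu> t - flux_x S (i-1) k m p \<mu> t) * p\<^sup>2)) \<le> C * cell_mass S i k m t"
proof -
  let ?f = "\<lambda>x p \<mu>. cell_lim S i k m x p \<mu> t"
  let ?a = "xface S (i-1)" and ?b = "xface S i"
  define J where "J p \<mu> = dt * ((flux_x S i k m p \<mu> t - flux_x S (i-1) k m p \<mu> t) * p\<^sup>2)" for p \<mu>
  define W where "W = C * (weight (rule_GL S) (npts (rule_GL S) - 1) * (?b - ?a))"
  note x_le = valid_faces_cell(1)[OF valid_dg_faces(1)[OF S] ikm(1), THEN less_imp_le]
    and p_le = valid_faces_cell(1)[OF valid_dg_faces(2)[OF S] ikm(2), THEN less_imp_le]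
    and m_le = valid_faces_cell(1)[OF valid_dg_faces(3)[OF S] ikm(3), THEN less_imp_le]
  note GL = valid_dg_rules(5)[OF S]
  have f_nonneg: "0 \<le> ?f x p \<mu>" if "x \<in> xnodes S (rule_GL S) i" "p \<in> pnodes S (rule_p S) k"
    "\<mu> \<in> mnodes S (rule_m S) m" for x p \<mu>
    using nonneg(1) that unfolding nonneg_in_cell_def cell_rules_def by auto
  have J: "J p \<mu> \<le> W * (?f ?a p \<mu> * p\<^sup>2 + ?f ?b p \<mu> * p\<^sup>2)"
    if nodes: "p \<in> pnodes S (rule_p S) k" "\<mu> \<in> mnodes S (rule_m S) m" for p \<mu>
  \<comment> \<open>Positivity of the slope is given for p > 0 only; at p = 0 the factor p^2 makes
    \<open>J\<close> vanish.\<close>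
  proof (cases "p = 0")
    case False
    let ?D = "deriv (eps S) p"
    have "p \<in> {0<..pmax S}"
      using False node_in_cell(2)[OF S ikm valid_dg_rules(2)[OF S] nodes(1)]
        valid_faces_cell(2,3)[OF valid_dg_faces(2)[OF S] ikm(2)] by auto
    then have D: "0 < ?D"
      using S by (simp add: valid_dg_def)
    have f: "0 \<le> ?f ?a p \<mu>" "0 \<le> ?f ?b p \<mu>"
      using f_nonneg nodes gauss_lobatto_endpoints[OF GL] by (auto simp: xnodes_def)
    have B: "0 \<le> lim_x_plus S i k m p \<mu> t" "0 \<le> lim_x_minus S (i-1) k m p \<mu> t"
      using nonneg(2) nodes unfolding nonneg_at_faces_def by auto
    \<comment> \<open>The limits from inside the cell are thus never boundary data; such data enter
      only as outer values, of which just the sign is used.\<close>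
    have "i \<noteq> 0" "i - 1 \<noteq> Nx S" "i - 1 + 1 = i"
      using ikm by auto
    then have lims: "lim_x_minus S i k m p \<mu> t = ?f ?b p \<mu>"
      "lim_x_plus S (i-1) k m p \<mu> t = ?f ?a p \<mu>"
      unfolding lim_x_minus_def lim_x_plus_def by simp_all
    have "flux_x S i k m p \<mu> t - flux_x S (i-1) k m p \<mu> t \<le> \<bar>\<mu>\<bar> * (?D * ?f ?a p \<mu> + ?D * ?f ?b p \<mu>)"
      unfolding flux_x_def lims using D f B by (intro upwind_outflow_le) auto
    then have "dt * p\<^sup>2 * (flux_x S i k m p \<mu> t - flux_x S (i-1) k m p \<mu> t)
        \<le> dt * p\<^sup>2 * (\<bar>\<mu>\<bar> * (?D * ?f ?a p \<mu> + ?D * ?f ?b p \<mu>))"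
      using dt by (intro mult_left_mono) auto
    then have "J p \<mu> \<le> (dt * ?D * \<bar>\<mu>\<bar>) * ((?f ?a p \<mu> + ?f ?b p \<mu>) * p\<^sup>2)"
      by (simp add: J_def algebra_simps)
    also have "\<dots> \<le> W * ((?f ?a p \<mu> + ?f ?b p \<mu>) * p\<^sup>2)"
    proof (rule mult_right_mono)
      have DM: "?D \<le> Max (deriv (eps S) ` pnodes S (rule_p S) k)"
        using nodes by (intro Max_ge) (auto simp: pnodes_def)
      have "\<bar>\<mu>\<bar> \<le> max \<bar>mface S (m-1)\<bar> \<bar>mface S m\<bar>"
        using node_in_cell(3)[OF S ikm valid_dg_rules(3)[OF S] nodes(2)] by auto
      then have "dt * ?D * \<bar>\<mu>\<bar>
          \<le> dt * Max (deriv (eps S) ` pnodes S (rule_p S) k) * max \<bar>mface S (m-1)\<bar> \<bar>mface S m\<bar>"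
        using dt D DM by (intro mult_mono mult_nonneg_nonneg) auto
      then show "dt * ?D * \<bar>\<mu>\<bar> \<le> W"
        using cfl by (simp add: W_def)
    qed (use f in auto)
    finally show ?thesis
      by (simp add: algebra_simps)
  qed (simp add: J_def)
  have "int_p S (rule_p S) k (\<lambda>p. int_m S (rule_m S) m (J p))
      \<le> C * int_x S (rule_GL S) i (\<lambda>x. int_p S (rule_p S) k (\<lambda>p. int_m S (rule_m S) m (\<lambda>\<mu>.
          ?f x p \<mu> * p\<^sup>2)))"
    unfolding int_x_def int_p_def
  proof (rule gauss_lobatto_dominates_outer[OF GL x_le valid_dg_rules(2)[OF S] p_le C])
    fix p assume p: "p \<in> qnodes (rule_p S) (pface S (k-1)) (pface S k)"
    show "0 \<le> int_m S (rule_m S) m (\<lambda>\<mu>. ?f x p \<mu> * p\<^sup>2)" if "x \<in> qnodes (rule_GL S) ?a ?b" for x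
      unfolding int_m_def using f_nonneg p that
      by (intro qint_nonneg valid_dg_rules[OF S] m_le) (auto simp: xnodes_def pnodes_def mnodes_def)
    have "int_m S (rule_m S) m (J p)
        \<le> int_m S (rule_m S) m (\<lambda>\<mu>. W * (?f ?a p \<mu> * p\<^sup>2 + ?f ?b p \<mu> * p\<^sup>2))"
      unfolding int_m_def using J p
      by (intro qint_mono valid_dg_rules[OF S] m_le) (auto simp: pnodes_def mnodes_def)
    then show "int_m S (rule_m S) m (J p)
        \<le> C * (weight (rule_GL S) (npts (rule_GL S) - 1) * (?b - ?a)) *
          (int_m S (rule_m S) m (\<lambda>\<mu>. ?f ?a p \<mu> * p\<^sup>2) + int_m S (rule_m S) m (\<lambda>\<mu>. ?f ?b p \<mu> * p\<^sup>2))"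
      unfolding int_m_def qint_cmult qint_add W_def .
  qed
  also have "int_p S (rule_p S) k (\<lambda>p. int_m S (rule_m S) m (J p))
      = dt * int_p S (rule_p S) k (\<lambda>p. int_m S (rule_m S) m (\<lambda>\<mu>.
          (flux_x S i k m p \<mu> t - flux_x S (i-1) k m p \<mu> t) * p\<^sup>2))"
    unfolding J_def int_p_def int_m_def qint_cmult ..
  also have "int_x S (rule_GL S) i (\<lambda>x. int_p S (rule_p S) k (\<lambda>p. int_m S (rule_m S) m (\<lambda>\<mu>.
      ?f x p \<mu> * p\<^sup>2))) = cell_mass S i k m t"
    using exact unfolding exact_mass_def cell_rules_def by auto
  finally show ?thesis .
qed

text \<open>The face factors p^2 coincide with the density of the mass at the endpoint nodes, so no
  power of p is left over in the CFL condition. The speed is -E * \<mu>.\<close>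

lemma transport_p_le:
  assumes S: "valid_dg S" and ikm: "i \<in> {1..Nx S}" "k \<in> {1..Np S}" "m \<in> {1..Nm S}"
    and dt: "0 < dt" and C: "0 \<le> C"
    and exact: "exact_mass S i k m t"
    and nonneg: "nonneg_in_cell S i k m t" "nonneg_at_faces S i k m t"
    and cfl: "dt * charge S * Max ((\<lambda>x. \<bar>Efield S x t\<bar>) ` xnodes S (rule_x S) i)
          * max \<bar>mface S (m-1)\<bar> \<bar>mface S m\<bar>
        \<le> C * (weight (rule_GL S) (npts (rule_GL S) - 1) * (pface S k - pface S (k-1)))"
  shows "dt * int_x S (rule_x S) i (\<lambda>x. int_m S (rule_m S) m (\<lambda>\<mu>.
          (pface S k)\<^sup>2 * flux_p S i k m x \<mu> t - (pface S (k-1))\<^sup>2 * flux_p S i (k-1) m x \<mu> t))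
        \<le> C * cell_mass S i k m t"
proof -
  let ?f = "\<lambda>x p \<mu>. cell_lim S i k m x p \<mu> t"
  let ?a = "pface S (k-1)" and ?b = "pface S k" and ?q = "charge S"
  define J where "J x \<mu> = dt * (?b\<^sup>2 * flux_p S i k m x \<mu> t - ?a\<^sup>2 * flux_p S i (k-1) m x \<mu> t)" for x \<mu>
  define W where "W = C * (weight (rule_GL S) (npts (rule_GL S) - 1) * (?b - ?a))"
  note x_le = valid_faces_cell(1)[OF valid_dg_faces(1)[OF S] ikm(1), THEN less_imp_le]
    and p_le = valid_faces_cell(1)[OF valid_dg_faces(2)[OF S] ikm(2), THEN less_imp_le]
    and m_le = valid_faces_cell(1)[OF valid_dg_faces(3)[OF S] ikm(3), THEN less_imp_le]
  note GL = valid_dg_rules(5)[OF S]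
  have q: "0 < ?q"
    using S by (simp add: valid_dg_def)
  have f_nonneg: "0 \<le> ?f x p \<mu>" if "x \<in> xnodes S (rule_x S) i" "p \<in> pnodes S (rule_GL S) k"
    "\<mu> \<in> mnodes S (rule_m S) m" for x p \<mu>
    using nonneg(1) that unfolding nonneg_in_cell_def cell_rules_def by auto
  have J: "J x \<mu> \<le> W * (?f x ?a \<mu> * ?a\<^sup>2 + ?f x ?b \<mu> * ?b\<^sup>2)"
    if nodes: "x \<in> xnodes S (rule_x S) i" "\<mu> \<in> mnodes S (rule_m S) m" for x \<mu>
  proof -
    let ?v = "- Efield S x t * \<mu>"
    have f: "0 \<le> ?f x ?a \<mu>" "0 \<le> ?f x ?b \<mu>"
      using f_nonneg nodes gauss_lobatto_endpoints[OF GL] by (auto simp: pnodes_def)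
    have B: "0 \<le> lim_p_plus S i k m x \<mu> t" "0 \<le> lim_p_minus S i (k-1) m x \<mu> t"
      using nonneg(2) nodes unfolding nonneg_at_faces_def by auto
    have "k \<noteq> 0" "k - 1 \<noteq> Np S" "k - 1 + 1 = k"
      using ikm by auto
    then have lims: "lim_p_minus S i k m x \<mu> t = ?f x ?b \<mu>"
      "lim_p_plus S i (k-1) m x \<mu> t = ?f x ?a \<mu>"
      unfolding lim_p_minus_def lim_p_plus_def by simp_all
    have "?b\<^sup>2 * flux_p S i k m x \<mu> t - ?a\<^sup>2 * flux_p S i (k-1) m x \<mu> t
        \<le> \<bar>?v\<bar> * (?a\<^sup>2 * ?q * ?f x ?a \<mu> + ?b\<^sup>2 * ?q * ?f x ?b \<mu>)"
      using upwind_outflow_le[of "?a\<^sup>2 * ?q" "?b\<^sup>2 * ?q" "?f x ?a \<mu>" "?f x ?b \<mu>"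
          "lim_p_minus S i (k-1) m x \<mu> t" "lim_p_plus S i k m x \<mu> t" ?v] q f B
      unfolding flux_p_def lims by (simp add: mult.assoc)
    then have "J x \<mu> \<le> dt * (\<bar>?v\<bar> * (?a\<^sup>2 * ?q * ?f x ?a \<mu> + ?b\<^sup>2 * ?q * ?f x ?b \<mu>))"
      unfolding J_def using dt by (intro mult_left_mono) auto
    also have "\<dots> = (dt * ?q * \<bar>Efield S x t\<bar> * \<bar>\<mu>\<bar>) * (?f x ?a \<mu> * ?a\<^sup>2 + ?f x ?b \<mu> * ?b\<^sup>2)"
      by (simp add: abs_mult algebra_simps)
    also have "\<dots> \<le> W * (?f x ?a \<mu> * ?a\<^sup>2 + ?f x ?b \<mu> * ?b\<^sup>2)"
    proof (rule mult_right_mono)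
      have EM: "\<bar>Efield S x t\<bar> \<le> Max ((\<lambda>x. \<bar>Efield S x t\<bar>) ` xnodes S (rule_x S) i)"
        using nodes by (intro Max_ge) (auto simp: xnodes_def)
      have "\<bar>\<mu>\<bar> \<le> max \<bar>mface S (m-1)\<bar> \<bar>mface S m\<bar>"
        using node_in_cell(3)[OF S ikm valid_dg_rules(3)[OF S] nodes(2)] by auto
      then have "dt * ?q * \<bar>Efield S x t\<bar> * \<bar>\<mu>\<bar>
          \<le> dt * ?q * Max ((\<lambda>x. \<bar>Efield S x t\<bar>) ` xnodes S (rule_x S) i)
            * max \<bar>mface S (m-1)\<bar> \<bar>mface S m\<bar>"
        using dt q EM by (intro mult_mono mult_nonneg_nonneg) auto
      then show "dt * ?q * \<bar>Efield S x t\<bar> * \<bar>\<mu>\<bar> \<le> W"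
        using cfl by (simp add: W_def)
    qed (use f in auto)
    finally show ?thesis .
  qed
  have "int_x S (rule_x S) i (\<lambda>x. int_m S (rule_m S) m (J x))
      \<le> int_x S (rule_x S) i (\<lambda>x. C * int_p S (rule_GL S) k (\<lambda>p. int_m S (rule_m S) m (\<lambda>\<mu>.
          ?f x p \<mu> * p\<^sup>2)))"
    unfolding int_x_def int_p_def int_m_def
    using f_nonneg J unfolding W_def xnodes_def pnodes_def mnodes_def
    by (intro qint_mono gauss_lobatto_dominates_outer valid_dg_rules[OF S] x_le p_le m_le C) auto
  also have "\<dots> = C * int_x S (rule_x S) i (\<lambda>x. int_p S (rule_GL S) k (\<lambda>p.
      int_m S (rule_m S) m (\<lambda>\<mu>. ?f x p \<mu> * p\<^sup>2)))"
    unfolding int_x_def qint_cmult ..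
  also have "int_x S (rule_x S) i (\<lambda>x. int_p S (rule_GL S) k (\<lambda>p.
      int_m S (rule_m S) m (\<lambda>\<mu>. ?f x p \<mu> * p\<^sup>2))) = cell_mass S i k m t"
    using exact unfolding exact_mass_def cell_rules_def by auto
  finally show ?thesis
    unfolding J_def int_x_def int_m_def qint_cmult .
qed

text \<open>Against the density p^2 the flux carries only p; the other power comes from
  \<open>pface S (k-1)\<close> \<le> p. For \<open>k = 1\<close> the right side of
  \<open>cfl\<close> is 0, which forces |E| times the larger face factor to vanish at the
  nodes.\<close>

lemma transport_m_le:
  assumes S: "valid_dg S" and ikm: "i \<in> {1..Nx S}" "k \<in> {1..Np S}" "m \<in> {1..Nm S}"
    and dt: "0 < dt" and C: "0 \<le> C"
    and exact: "exact_mass S i k m t"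
    and nonneg: "nonneg_in_cell S i k m t" "nonneg_at_faces S i k m t"
    and cfl: "dt * charge S * Max ((\<lambda>x. \<bar>Efield S x t\<bar>) ` xnodes S (rule_x S) i)
          * max (1 - (mface S (m-1))\<^sup>2) (1 - (mface S m)\<^sup>2)
        \<le> C * (weight (rule_GL S) (npts (rule_GL S) - 1) * (mface S m - mface S (m-1)))
          * pface S (k-1)"
  shows "dt * int_x S (rule_x S) i (\<lambda>x. int_p S (rule_p S) k (\<lambda>p.
          ((1 - (mface S m)\<^sup>2) * flux_m S i k m x p t
         - (1 - (mface S (m-1))\<^sup>2) * flux_m S i k (m-1) x p t) * p))
        \<le> C * cell_mass S i k m t"
proof -
  let ?f = "\<lambda>x p \<mu>. cell_lim S i k m x p \<mu> t"
  let ?a = "mface S (m-1)" and ?b = "mface S m" and ?q = "charge S"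
  define J where "J x p = dt * (((1 - ?b\<^sup>2) * flux_m S i k m x p t
    - (1 - ?a\<^sup>2) * flux_m S i k (m-1) x p t) * p)" for x p
  define W where "W = C * (weight (rule_GL S) (npts (rule_GL S) - 1) * (?b - ?a))"
  define M where "M = max (1 - ?a\<^sup>2) (1 - ?b\<^sup>2)"
  note x_le = valid_faces_cell(1)[OF valid_dg_faces(1)[OF S] ikm(1), THEN less_imp_le]
    and p_le = valid_faces_cell(1)[OF valid_dg_faces(2)[OF S] ikm(2), THEN less_imp_le]
    and m_le = valid_faces_cell(1)[OF valid_dg_faces(3)[OF S] ikm(3), THEN less_imp_le]
  note GL = valid_dg_rules(5)[OF S]
  have q: "0 < ?q"
    using S by (simp add: valid_dg_def)
  have w: "0 \<le> 1 - ?a\<^sup>2" "0 \<le> 1 - ?b\<^sup>2"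
    using valid_faces_cell[OF valid_dg_faces(3)[OF S] ikm(3)]
    by (auto simp: abs_square_le_1 abs_le_iff)
  have "0 < weight (rule_GL S) (npts (rule_GL S) - 1)"
    using GL unfolding gauss_lobatto_rule_def positive_rule_def by simp
  then have W: "0 \<le> W"
    using m_le C by (simp add: W_def)
  have f_nonneg: "0 \<le> ?f x p \<mu>" if "x \<in> xnodes S (rule_x S) i" "p \<in> pnodes S (rule_p S) k"
    "\<mu> \<in> mnodes S (rule_GL S) m" for x p \<mu>
    using nonneg(1) that unfolding nonneg_in_cell_def cell_rules_def by auto
  have J: "J x p \<le> W * (?f x p ?a * p\<^sup>2 + ?f x p ?b * p\<^sup>2)"
    if nodes: "x \<in> xnodes S (rule_x S) i" "p \<in> pnodes S (rule_p S) k" for x p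
  proof -
    let ?v = "- Efield S x t"
    have p: "0 \<le> pface S (k-1)" "pface S (k-1) \<le> p"
      using node_in_cell(2)[OF S ikm valid_dg_rules(2)[OF S] nodes(2)]
        valid_faces_cell(2)[OF valid_dg_faces(2)[OF S] ikm(2)] by auto
    have f: "0 \<le> ?f x p ?a" "0 \<le> ?f x p ?b"
      using f_nonneg nodes gauss_lobatto_endpoints[OF GL] by (auto simp: mnodes_def)
    have B: "0 \<le> lim_m_plus S i k m x p t" "0 \<le> lim_m_minus S i k (m-1) x p t"
      using nonneg(2) nodes unfolding nonneg_at_faces_def by auto
    have "m \<noteq> 0" "m - 1 \<noteq> Nm S" "m - 1 + 1 = m"
      using ikm by auto
    then have lims: "lim_m_minus S i k m x p t = ?f x p ?b"
      "lim_m_plus S i k (m-1) x p t = ?f x p ?a"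
      unfolding lim_m_minus_def lim_m_plus_def by simp_all
    have "(1 - ?b\<^sup>2) * flux_m S i k m x p t - (1 - ?a\<^sup>2) * flux_m S i k (m-1) x p t
        \<le> \<bar>?v\<bar> * ((1 - ?a\<^sup>2) * ?q * ?f x p ?a + (1 - ?b\<^sup>2) * ?q * ?f x p ?b)"
      using upwind_outflow_le[of "(1 - ?a\<^sup>2) * ?q" "(1 - ?b\<^sup>2) * ?q" "?f x p ?a" "?f x p ?b"
          "lim_m_minus S i k (m-1) x p t" "lim_m_plus S i k m x p t" ?v] q f B w
      unfolding flux_m_def lims by (simp add: mult.assoc)
    \<comment> \<open>The mass density contains no factor 1 - \<mu>^2, so both face factors are
      replaced by their maximum, as in the CFL condition.\<close>
    also have "\<dots> \<le> \<bar>?v\<bar> * (M * ?q * ?f x p ?a + M * ?q * ?f x p ?b)"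
      unfolding M_def using q f by (intro mult_left_mono add_mono mult_right_mono) auto
    finally have "dt * p * ((1 - ?b\<^sup>2) * flux_m S i k m x p t - (1 - ?a\<^sup>2) * flux_m S i k (m-1) x p t)
        \<le> dt * p * (\<bar>?v\<bar> * (M * ?q * ?f x p ?a + M * ?q * ?f x p ?b))"
      using dt p by (intro mult_left_mono) auto
    then have "J x p \<le> (dt * ?q * \<bar>Efield S x t\<bar> * M) * (p * (?f x p ?a + ?f x p ?b))"
      by (simp add: J_def algebra_simps)
    \<comment> \<open>The missing power of p is gained here; \<open>0 \<le> W\<close> is needed to
      enlarge the lower face value to p.\<close>
    also have "\<dots> \<le> (W * p) * (p * (?f x p ?a + ?f x p ?b))"
    proof (rule mult_right_mono)
      have EM: "\<bar>Efield S x t\<bar> \<le> Max ((\<lambda>x. \<bar>Efield S x t\<bar>) ` xnodes S (rule_x S) i)"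
        using nodes by (intro Max_ge) (auto simp: xnodes_def)
      have "0 \<le> M"
        using w by (simp add: M_def)
      then have "dt * ?q * \<bar>Efield S x t\<bar> * M
          \<le> dt * ?q * Max ((\<lambda>x. \<bar>Efield S x t\<bar>) ` xnodes S (rule_x S) i) * M"
        using dt q EM by (intro mult_mono mult_nonneg_nonneg) auto
      also have "\<dots> \<le> W * pface S (k-1)"
        using cfl by (simp add: W_def M_def)
      also have "\<dots> \<le> W * p"
        using W p by (intro mult_left_mono)
      finally show "dt * ?q * \<bar>Efield S x t\<bar> * M \<le> W * p" .
    qed (use f p in auto)
    finally show ?thesis
      by (simp add: power2_eq_square algebra_simps)
  qed
  have "int_x S (rule_x S) i (\<lambda>x. int_p S (rule_p S) k (J x))
      \<le> int_x S (rule_x S) i (\<lambda>x. C * int_p S (rule_p S) k (\<lambda>p. int_m S (rule_GL S) m (\<lambda>\<mu>.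
          ?f x p \<mu> * p\<^sup>2)))"
    unfolding int_x_def int_p_def int_m_def
    using f_nonneg J unfolding W_def xnodes_def pnodes_def mnodes_def
    by (intro qint_mono gauss_lobatto_dominates_inner valid_dg_rules[OF S] x_le p_le m_le C) auto
  also have "\<dots> = C * int_x S (rule_x S) i (\<lambda>x. int_p S (rule_p S) k (\<lambda>p.
      int_m S (rule_GL S) m (\<lambda>\<mu>. ?f x p \<mu> * p\<^sup>2)))"
    unfolding int_x_def qint_cmult ..
  also have "int_x S (rule_x S) i (\<lambda>x. int_p S (rule_p S) k (\<lambda>p.
      int_m S (rule_GL S) m (\<lambda>\<mu>. ?f x p \<mu> * p\<^sup>2))) = cell_mass S i k m t"
    using exact unfolding exact_mass_def cell_rules_def by auto
  finally show ?thesis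
    unfolding J_def int_x_def int_p_def qint_cmult .
qed

theorem mainTheorem1:
  fixes S :: dg and i k m n :: nat and tm :: "nat \<Rightarrow> real" and dt \<alpha> s1 s2 s3 wN :: real
  assumes setting: "valid_dg S"
    and cell_index: "i \<in> {1..Nx S}" "k \<in> {1..Np S}" "m \<in> {1..Nm S}"
    and time_step: "dt = tm (Suc n) - tm n" "dt > 0"
    and wN: "wN = weight (rule_GL S) (npts (rule_GL S) - 1)"
    and exact: "exact_mass S i k m (tm n)"
    and update: "cell_avg S i k m (tm (Suc n)) =
        cell_avg S i k m (tm n) + Gamma_T S i k m (tm n) dt + Gamma_C S i k m (tm n) dt"
    and alpha: "0 < \<alpha>" "\<alpha> < 1"
    and s: "s1 \<ge> 0" "s2 \<ge> 0" "s3 \<ge> 0" "s1 + s2 + s3 = 1"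
    and nonneg: "nonneg_in_cell S i k m (tm n)" "nonneg_at_faces S i k m (tm n)"
    and cfl_x: "dt * Max (deriv (eps S) ` pnodes S (rule_p S) k)
          * max \<bar>mface S (m-1)\<bar> \<bar>mface S m\<bar>
        \<le> \<alpha> * s1 * wN * (xface S i - xface S (i-1))"
    and cfl_p: "dt * charge S * Max ((\<lambda>x. \<bar>Efield S x (tm n)\<bar>) ` xnodes S (rule_x S) i)
          * max \<bar>mface S (m-1)\<bar> \<bar>mface S m\<bar>
        \<le> \<alpha> * s2 * wN * (pface S k - pface S (k-1))"
    and cfl_m: "dt * charge S * Max ((\<lambda>x. \<bar>Efield S x (tm n)\<bar>) ` xnodes S (rule_x S) i)
          * max (1 - (mface S (m-1))\<^sup>2) (1 - (mface S m)\<^sup>2)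
        \<le> \<alpha> * s3 * wN * (mface S m - mface S (m-1)) * pface S (k-1)"
    and collision_condition:
      "(nonneg_at_gain_points S i k m (tm n) \<and>
          dt * Max (nu S ` pnodes S (rule_p S) k) < 1 - \<alpha>) \<or>
       (negQ_points S i k m (tm n) \<noteq> {} \<longrightarrow>
          dt \<le> (1 - \<alpha>) * Min ((\<lambda>(x, p, \<mu>). cell_lim S i k m x p \<mu> (tm n)
                    / \<bar>Qh S i k m x p \<mu> (tm n)\<bar>) ` negQ_points S i k m (tm n)))"
  shows "cell_avg S i k m (tm n) + Gamma_T S i k m (tm n) dt / \<alpha> \<ge> 0 \<and>
         cell_avg S i k m (tm n) + Gamma_C S i k m (tm n) dt / (1 - \<alpha>) \<ge> 0 \<and>
         cell_avg S i k m (tm (Suc n)) \<ge> 0"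
proof -
  let ?t = "tm n" and ?V = "cell_volume S i k m" and ?M = "cell_mass S i k m (tm n)"
  let ?X = "int_p S (rule_p S) k (\<lambda>p. int_m S (rule_m S) m (\<lambda>\<mu>.
      (flux_x S i k m p \<mu> ?t - flux_x S (i-1) k m p \<mu> ?t) * p\<^sup>2))"
    and ?P = "int_x S (rule_x S) i (\<lambda>x. int_m S (rule_m S) m (\<lambda>\<mu>.
      (pface S k)\<^sup>2 * flux_p S i k m x \<mu> ?t - (pface S (k-1))\<^sup>2 * flux_p S i (k-1) m x \<mu> ?t))"
    and ?U = "int_x S (rule_x S) i (\<lambda>x. int_p S (rule_p S) k (\<lambda>p.
      ((1 - (mface S m)\<^sup>2) * flux_m S i k m x p ?t
     - (1 - (mface S (m-1))\<^sup>2) * flux_m S i k (m-1) x p ?t) * p))"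
  note ctx = setting cell_index time_step(2)
  have "dt * ?X \<le> \<alpha> * s1 * ?M"
    using cfl_x alpha s by (intro transport_x_le ctx exact nonneg) (auto simp: wN mult_ac)
  moreover have "dt * ?P \<le> \<alpha> * s2 * ?M"
    using cfl_p alpha s by (intro transport_p_le ctx exact nonneg) (auto simp: wN mult_ac)
  moreover have "dt * ?U \<le> \<alpha> * s3 * ?M"
    using cfl_m alpha s by (intro transport_m_le ctx exact nonneg) (auto simp: wN mult_ac)
  moreover have "\<alpha> * s1 * ?M + \<alpha> * s2 * ?M + \<alpha> * s3 * ?M = \<alpha> * ?M"
    using s(4) by (metis distrib_left distrib_right mult.right_neutral)
  ultimately have "dt * (?X + ?P + ?U) \<le> \<alpha> * ?M"
    by (simp add: distrib_left)
  then have "0 \<le> (\<alpha> * ?M - dt * (?X + ?P + ?U)) / (\<alpha> * ?V)"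
    using alpha cell_volume_nonneg[of S i k m] by simp
  also have "\<dots> = cell_avg S i k m ?t + Gamma_T S i k m ?t dt / \<alpha>"
    using alpha unfolding cell_avg_def Gamma_T_def by (simp add: diff_divide_distrib)
  finally have T: "0 \<le> cell_avg S i k m ?t + Gamma_T S i k m ?t dt / \<alpha>" .
  have C: "0 \<le> cell_avg S i k m ?t + Gamma_C S i k m ?t dt / (1 - \<alpha>)"
    using alpha collision_condition by (intro collision_part_nonneg ctx exact nonneg) auto
  \<comment> \<open>The Euler update is exactly this convex combination; the divisions by \<alpha>
    and 1 - \<alpha> cancel.\<close>
  have "0 \<le> \<alpha> * (cell_avg S i k m ?t + Gamma_T S i k m ?t dt / \<alpha>)
      + (1 - \<alpha>) * (cell_avg S i k m ?t + Gamma_C S i k m ?t dt / (1 - \<alpha>))"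
    using T C alpha by simp
  also have "\<dots> = cell_avg S i k m (tm (Suc n))"
    using alpha unfolding update by (simp add: field_simps)
  finally show ?thesis
    using T C by simp
qed

end
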